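(* Let $d=2m$ be an even positive integer, let $\lambda_k=\cos(k\pi/d)$, and let $T_d$ be the Chebyshev polynomial of degree $d$. Then the polynomial $F_d^+(x,y)=T_d(x)+T_d(y)$ splits, up to a nonzero constant factor, as a product of the quadratic factors $$g^+_k(x,y)= x^2+2\lambda_{2k-1}xy+y^2-(1-\lambda_{2k-1}^2),\qquad k=1,\dots,m.$$ In particular, in this case the polynomials $F_d^+(x,y)$ and $F_d^-(x,y)=T_d(x)-T_d(y)$ are not affinely equivalent.
   Context: The Chebyshev polynomial $T_d(x)$ is the polynomial of degree $d$ determined by $T_d(x)=\cos(d\arccos x)$. Two polynomials in $\mathbb{C}[x,y]$ are affinely equivalent if one is obtained from the other by composition with an invertible affine transformation of the (complex) plane with coordinates $x,y$. *)

theory Defs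
  imports "HOL-Analysis.Analysis" "HOL-Computational_Algebra.Polynomial"
begin

definition chebyshev :: "nat \<Rightarrow> real poly" where
  "chebyshev d =
     (THE p. degree p = d \<and> (\<forall>x\<in>{-1..1}. poly p x = cos (real d * arccos x)))"

lemma chebyshev_exists_aux:
  "\<exists>p q :: real poly. degree p = n \<and> degree q = Suc n \<and>
     (\<forall>t. poly p (cos t) = cos (real n * t) \<and> poly q (cos t) = cos (real (Suc n) * t))"
proof (induction n)
  case 0
  show ?case by (intro exI[of _ 1] exI[of _ "[:0, 1:]"]) auto
next
  case (Suc n)
  then obtain p q :: "real poly" where pq: "degree p = n" "degree q = Suc n"
    "\<And>t. poly p (cos t) = cos (real n * t)" "\<And>t. poly q (cos t) = cos (real (Suc n) * t)"
    by blast
  have "degree ([:0, 2:] * q) = Suc (Suc n)"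
    using pq(2) by (subst degree_mult_eq) auto
  moreover have "degree (- p) < Suc (Suc n)"
    using pq(1) by simp
  ultimately have "degree ([:0, 2:] * q + - p) = Suc (Suc n)"
    by (simp only: degree_add_eq_left)
  moreover have "poly ([:0, 2:] * q + - p) (cos t) = cos (real (Suc (Suc n)) * t)" for t
  proof -
    have "real (Suc (Suc n)) * t = real (Suc n) * t + t" "real n * t = real (Suc n) * t - t"
      by (simp_all add: algebra_simps)
    thus ?thesis
      by (simp only: poly_add poly_mult poly_minus pq cos_add cos_diff) simp
  qed
  ultimately show ?case using pq by blast
qed

lemma chebyshev_unique_existence:
  "\<exists>!p. degree p = d \<and> (\<forall>x\<in>{-1..1}. poly p x = cos (real d * arccos x))"
proof -
  obtain p :: "real poly" where p: "degree p = d" "\<And>t. poly p (cos t) = cos (real d * t)"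
    using chebyshev_exists_aux[of d] by blast
  have "poly p x = cos (real d * arccos x)" if "x \<in> {-1..1}" for x
    using p(2)[of "arccos x"] that by simp
  moreover have "q = p'"
    if "\<forall>x\<in>{-1..1}. poly q x = cos (real d * arccos x)"
       "\<forall>x\<in>{-1..1}. poly p' x = cos (real d * arccos x)" for q p' :: "real poly"
  proof (rule ccontr)
    assume "q \<noteq> p'"
    hence "finite {x. poly (q - p') x = 0}"
      by (intro poly_roots_finite) simp
    moreover have "{-1..1::real} \<subseteq> {x. poly (q - p') x = 0}"
      using that by auto
    ultimately have "finite {-1..1::real}"
      by (rule rev_finite_subset)
    thus False by (simp add: infinite_Icc)
  qed
  ultimately show ?thesis using p(1) by blast
qed

lemma degree_chebyshev: "degree (chebyshev d) = d"
  and poly_chebyshev: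
    "x \<in> {-1..1} \<Longrightarrow> poly (chebyshev d) x = cos (real d * arccos x)"
  using theI'[OF chebyshev_unique_existence[of d]] unfolding chebyshev_def by blast+

text \<open>
  Elements of \<open>\<complex>[x,y]\<close> are represented as elements of \<open>\<complex>[x][y]\<close>, i.e. polynomials in
  \<open>y\<close> (the outer variable) whose coefficients are polynomials in \<open>x\<close> (the inner variable).
\<close>

definition bconst :: "complex \<Rightarrow> complex poly poly" where
  "bconst c = [:[:c:]:]"

definition varX :: "complex poly poly" where
  "varX = [:[:0, 1:]:]"

definition varY :: "complex poly poly" where
  "varY = [:0, 1:]"

text \<open>\<open>subst1 p u\<close> is \<open>p(u)\<close>, and \<open>subst2 p u v\<close> is \<open>p(u,v)\<close>, i.e. \<open>x\<close> is replaced by \<open>u\<close>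
  and \<open>y\<close> by \<open>v\<close> simultaneously.\<close>

definition subst1 :: "complex poly \<Rightarrow> complex poly poly \<Rightarrow> complex poly poly" where
  "subst1 p u = poly (map_poly bconst p) u"

definition subst2 ::
    "complex poly poly \<Rightarrow> complex poly poly \<Rightarrow> complex poly poly \<Rightarrow> complex poly poly" where
  "subst2 p u v = poly (map_poly (\<lambda>q. subst1 q u) p) v"

definition eval2 :: "complex poly poly \<Rightarrow> complex \<Rightarrow> complex \<Rightarrow> complex" where
  "eval2 p x y = poly (poly p [:y:]) x"

lemma eval2_simps [simp]:
  "eval2 0 x y = 0" "eval2 1 x y = 1"
  "eval2 (bconst c) x y = c" "eval2 varX x y = x" "eval2 varY x y = y"
  "eval2 (p + q) x y = eval2 p x y + eval2 q x y"
  "eval2 (p - q) x y = eval2 p x y - eval2 q x y"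
  "eval2 (p * q) x y = eval2 p x y * eval2 q x y"
  "eval2 (p ^ n) x y = eval2 p x y ^ n"
  by (simp_all add: eval2_def bconst_def varX_def varY_def poly_power)

lemma eval2_subst1: "eval2 (subst1 p u) x y = poly p (eval2 u x y)"
  by (induction p) (simp_all add: subst1_def map_poly_pCons, simp_all add: bconst_def eval2_def map_poly_pCons)

lemma eval2_subst2: "eval2 (subst2 p u v) x y = eval2 p (eval2 u x y) (eval2 v x y)"
proof (induction p)
  case 0
  thus ?case by (simp add: subst2_def)
next
  case (pCons a p)
  have "subst2 (pCons a p) u v = subst1 a u + v * subst2 p u v"
    by (simp add: subst2_def map_poly_pCons subst1_def)
  thus ?case using pCons.IH by (simp add: eval2_subst1) (simp add: eval2_def)
qed

lemma eval2_eqI: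
  assumes "\<And>x y. eval2 p x y = eval2 q x y"
  shows "p = q"
proof (rule ccontr)
  assume "p \<noteq> q"
  hence "finite {r. poly (p - q) r = 0}"
    by (intro poly_roots_finite) simp
  moreover have "poly (p - q) [:y:] = 0" for y
  proof -
    have "poly (poly (p - q) [:y:]) = poly 0"
      using assms by (intro ext) (simp add: eval2_def)
    thus ?thesis by (simp only: poly_eq_poly_eq_iff)
  qed
  hence "range (\<lambda>y::complex. [:y:]) \<subseteq> {r. poly (p - q) r = 0}" by blast
  ultimately have "finite (range (\<lambda>y::complex. [:y:]))"
    by (rule rev_finite_subset)
  moreover have "inj (\<lambda>y::complex. [:y:])" by (auto intro: injI)
  ultimately have "finite (UNIV :: complex set)" by (rule finite_imageD)
  thus False using infinite_UNIV_char_0 by blast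
qed

definition affinely_equivalent :: "complex poly poly \<Rightarrow> complex poly poly \<Rightarrow> bool" where
  "affinely_equivalent p q \<longleftrightarrow>
     (\<exists>a b c d r s. a * d - b * c \<noteq> 0 \<and>
        q = subst2 p (bconst a * varX + bconst b * varY + bconst r)
                     (bconst c * varX + bconst d * varY + bconst s))"

lemma affinely_equivalent_sym:
  assumes "affinely_equivalent p q"
  shows "affinely_equivalent q p"
proof -
  obtain a b c d r s where D: "a * d - b * c \<noteq> 0"
    and q: "q = subst2 p (bconst a * varX + bconst b * varY + bconst r)
                     (bconst c * varX + bconst d * varY + bconst s)"
    using assms unfolding affinely_equivalent_def by blast
  define D where "D = a * d - b * c"
  have D0: "D \<noteq> 0" using D by (simp add: D_def)
  have "p = subst2 q
      (bconst (d/D) * varX + bconst (-b/D) * varY + bconst ((b * s - d * r)/D))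
      (bconst (-c/D) * varX + bconst (a/D) * varY + bconst ((c * r - a * s)/D))"
  proof (rule eval2_eqI, goal_cases)
    case (1 x y)
    have "a * (d/D * x + (-b/D) * y + (b * s - d * r)/D) + b * (-c/D * x + a/D * y + (c * r - a * s)/D) + r
            = (D * x - D * r) / D + r"
      by (simp add: D_def diff_divide_distrib add_divide_distrib algebra_simps)
    hence X: "a * (d/D * x + (-b/D) * y + (b * s - d * r)/D) + b * (-c/D * x + a/D * y + (c * r - a * s)/D) + r = x"
      using D0 by (simp add: diff_divide_distrib)
    have "c * (d/D * x + (-b/D) * y + (b * s - d * r)/D) + d * (-c/D * x + a/D * y + (c * r - a * s)/D) + s
            = (D * y - D * s) / D + s"
      by (simp add: D_def diff_divide_distrib add_divide_distrib algebra_simps)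
    hence Y: "c * (d/D * x + (-b/D) * y + (b * s - d * r)/D) + d * (-c/D * x + a/D * y + (c * r - a * s)/D) + s = y"
      using D0 by (simp add: diff_divide_distrib)
    show ?case
      unfolding q by (simp only: eval2_subst2 eval2_simps X Y)
  qed
  moreover have "(d/D) * (a/D) - (-b/D) * (-c/D) \<noteq> 0"
  proof -
    have "(d/D) * (a/D) - (-b/D) * (-c/D) = D / (D * D)"
      by (simp add: D_def diff_divide_distrib mult.commute)
    thus ?thesis using D0 by simp
  qed
  ultimately show ?thesis unfolding affinely_equivalent_def by blast
qed

definition chebyshev_complex :: "nat \<Rightarrow> complex poly" where
  "chebyshev_complex d = map_poly complex_of_real (chebyshev d)"

definition F_plus :: "nat \<Rightarrow> complex poly poly" where
  "F_plus d = subst1 (chebyshev_complex d) varX + subst1 (chebyshev_complex d) varY"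

definition F_minus :: "nat \<Rightarrow> complex poly poly" where
  "F_minus d = subst1 (chebyshev_complex d) varX - subst1 (chebyshev_complex d) varY"

definition cheb_lambda :: "nat \<Rightarrow> nat \<Rightarrow> real" where
  "cheb_lambda d k = cos (real k * pi / real d)"

text \<open>The index \<open>2 * k - 1\<close> uses truncated subtraction; only \<open>k \<ge> 1\<close> is meaningful.\<close>

definition g_plus :: "nat \<Rightarrow> nat \<Rightarrow> complex poly poly" where
  "g_plus d k =
     (let l = complex_of_real (cheb_lambda d (2 * k - 1))
      in varX ^ 2 + bconst (2 * l) * varX * varY + varY ^ 2 - bconst (1 - l ^ 2))"

end

theory Submission
  imports Defs
begin

text \<open>
  Put \<open>x = cos a\<close>, \<open>y = cos b\<close>. Then \<open>T\<^sub>2\<^sub>m(x) + T\<^sub>2\<^sub>m(y) = 2 T\<^sub>m(cos (a + b)) T\<^sub>m(cos (a - b))\<close>, the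
  roots of \<open>T\<^sub>m\<close> are the numbers \<open>-\<lambda>\<^bsub>2k-1\<^esub>\<close> for \<open>k = 1, \<dots>, m\<close>, and
  \<open>(cos (a + b) + \<lambda>) (cos (a - b) + \<lambda>) = x\<^sup>2 + 2\<lambda>xy + y\<^sup>2 - (1 - \<lambda>\<^sup>2)\<close>.
  For the second claim, \<open>F_minus\<close> vanishes on the line \<open>x = y\<close>, whereas \<open>F_plus\<close> vanishes
  on no line, being a product of equations of smooth conics.
\<close>

text \<open>\<open>chebyshev\<close> is specified by its values on [-1, 1] only, but the
  factorization is checked at complex points, so the cosine identity is needed for complex angles.
  Carrying two consecutive polynomials makes the recurrence T_(n+2) = 2 x T_(n+1) - T_n available to
  the induction.\<close>

lemma complex_chebyshev_exists:
  "\<exists>p q :: complex poly. \<forall>z. poly p (cos z) = cos (of_nat n * z) \<and>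
     poly q (cos z) = cos (of_nat (Suc n) * z)"
proof (induction n)
  case 0
  show ?case by (intro exI[of _ 1] exI[of _ "[:0, 1:]"]) auto
next
  case (Suc n)
  then obtain p q :: "complex poly" where pq: "\<And>z. poly p (cos z) = cos (of_nat n * z)"
    "\<And>z. poly q (cos z) = cos (of_nat (Suc n) * z)"
    by blast
  have "poly ([:0, 2:] * q + - p) (cos z) = cos (of_nat (Suc (Suc n)) * z)" for z
  proof -
    have "of_nat (Suc (Suc n)) * z = of_nat (Suc n) * z + z" "of_nat n * z = of_nat (Suc n) * z - z"
      by (simp_all add: algebra_simps)
    thus ?thesis
      by (simp only: poly_add poly_mult poly_minus pq cos_add cos_diff) simp
  qed
  thus ?case using pq by blast
qed

lemma poly_map_of_real:
  "poly (map_poly complex_of_real p) (of_real x) = of_real (poly p x)"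
  by (induction p) (simp_all add: map_poly_pCons)

text \<open>The polynomial just constructed agrees with \<open>chebyshev_complex n\<close> on the
  infinite set [-1, 1], hence everywhere.\<close>

lemma poly_chebyshev_complex_cos:
  "poly (chebyshev_complex n) (cos z) = cos (of_nat n * z)"
proof -
  obtain p :: "complex poly" where p: "\<And>z. poly p (cos z) = cos (of_nat n * z)"
    using complex_chebyshev_exists by blast
  have "poly (p - chebyshev_complex n) (of_real x) = 0" if "x \<in> {-1..1}" for x
  proof -
    have "poly p (of_real x) = poly p (cos (of_real (arccos x)))"
      using that by (simp add: cos_of_real)
    also have "\<dots> = of_real (cos (real n * arccos x))"
      by (simp only: p cos_of_real[symmetric]) simp
    also have "\<dots> = poly (chebyshev_complex n) (of_real x)"
      using that by (simp add: chebyshev_complex_def poly_map_of_real poly_chebyshev)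
    finally show ?thesis by simp
  qed
  hence "complex_of_real ` {-1..1} \<subseteq> {z. poly (p - chebyshev_complex n) z = 0}"
    by blast
  moreover have "infinite (complex_of_real ` {-1..1})"
    by (subst finite_image_iff) (auto simp: inj_on_def infinite_Icc)
  ultimately have "infinite {z. poly (p - chebyshev_complex n) z = 0}"
    using finite_subset by blast
  hence "p = chebyshev_complex n"
    using poly_roots_finite[of "p - chebyshev_complex n"] by auto
  thus ?thesis using p by simp
qed

lemma degree_chebyshev_complex: "degree (chebyshev_complex n) = n"
  by (simp add: chebyshev_complex_def degree_map_poly degree_chebyshev)

text \<open>On this open interval cosine is injective and sine is positive: the first makes the
  \<open>cheb_lambda\<close> values distinct, the second keeps their squares away from 1.\<close>

lemma odd_angle_range:
  assumes "k \<in> {1..m}"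
  shows "real (2 * k - 1) * pi / real (2 * m) \<in> {0<..<pi}"
proof -
  have "0 < real (2 * k - 1)" "real (2 * k - 1) / real (2 * m) < 1"
    using assms by auto
  moreover from this(2) have "real (2 * k - 1) / real (2 * m) * pi < 1 * pi"
    by (intro mult_strict_right_mono) auto
  ultimately show ?thesis using assms by simp
qed

lemma poly_chebyshev_complex_lambda:
  assumes "k \<in> {1..m}"
  shows "poly (chebyshev_complex m) (- of_real (cheb_lambda (2 * m) (2 * k - 1))) = 0"
proof -
  define t where "t = real (2 * k - 1) * pi / real (2 * m)"
  have "real m * t = real k * pi - pi / 2"
    using assms by (auto simp: t_def of_nat_diff field_simps)
  \<comment> \<open>Passing to the supplementary angle \<open>pi - t\<close> accounts for the minus
    sign; m times it is an odd multiple of pi/2, where cosine vanishes.\<close>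
  hence eq: "real m * (pi - t) = real (m - k) * pi + pi / 2"
    using assms by (simp add: of_nat_diff algebra_simps)
  have "- of_real (cheb_lambda (2 * m) (2 * k - 1)) = cos (complex_of_real (pi - t))"
    by (simp only: cos_of_real) (simp add: cheb_lambda_def t_def)
  hence "poly (chebyshev_complex m) (- of_real (cheb_lambda (2 * m) (2 * k - 1))) =
      cos (of_real (real m * (pi - t)))"
    by (simp add: poly_chebyshev_complex_cos)
  also have "\<dots> = 0"
    by (simp only: eq cos_of_real) (simp add: cos_add)
  finally show ?thesis .
qed

lemma inj_on_cheb_lambda_odd:
  "inj_on (\<lambda>k. cheb_lambda (2 * m) (2 * k - 1)) {1..m}"
proof (rule inj_onI)
  fix j k assume jk: "j \<in> {1..m}" "k \<in> {1..m}"
    and eq: "cheb_lambda (2 * m) (2 * j - 1) = cheb_lambda (2 * m) (2 * k - 1)"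
  have "real (2 * j - 1) * pi / real (2 * m) = real (2 * k - 1) * pi / real (2 * m)"
    using odd_angle_range[OF jk(1)] odd_angle_range[OF jk(2)] eq
    by - (rule cos_inj_pi, auto simp: cheb_lambda_def)
  moreover have "real (2 * m) \<noteq> 0" using jk by simp
  ultimately have "real (2 * j - 1) = real (2 * k - 1)"
    by (simp only: divide_cancel_right mult_cancel_right pi_neq_zero simp_thms)
  hence "2 * j - 1 = 2 * k - 1" by (simp only: of_nat_eq_iff)
  thus "j = k" using jk unfolding atLeastAtMost_iff by linarith
qed

lemma cheb_lambda_odd_sq:
  assumes "k \<in> {1..m}"
  shows "cheb_lambda (2 * m) (2 * k - 1) ^ 2 \<noteq> 1"
proof -
  have "sin (real (2 * k - 1) * pi / real (2 * m)) > 0"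
    using odd_angle_range[OF assms] by (intro sin_gt_zero) auto
  thus ?thesis
    unfolding cheb_lambda_def cos_squared_eq by simp
qed

text \<open>Both sides have degree at most m, share the coefficient at m, and vanish at the same m
  distinct points.\<close>

lemma chebyshev_complex_eq_prod:
  "chebyshev_complex m = smult (lead_coeff (chebyshev_complex m))
     (\<Prod>k=1..m. [:of_real (cheb_lambda (2 * m) (2 * k - 1)), 1:])"
    (is "?T = smult ?c (\<Prod>k=1..m. [:?l k, 1:])")
proof (rule poly_eqI_degree_lead_coeff[where n = m and A = "(\<lambda>k. - ?l k) ` {1..m}"])
  have deg: "degree (\<Prod>k=1..m. [:?l k, 1:]) = m"
    by (subst degree_prod_eq_sum_degree) auto
  have "lead_coeff (\<Prod>k=1..m. [:?l k, 1:]) = 1"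
    by (simp add: lead_coeff_prod)
  thus "coeff ?T m = coeff (smult ?c (\<Prod>k=1..m. [:?l k, 1:])) m"
    by (simp only: deg degree_chebyshev_complex coeff_smult mult_1_right)
  show "degree ?T \<le> m" "degree (smult ?c (\<Prod>k=1..m. [:?l k, 1:])) \<le> m"
    using degree_smult_le[of ?c "\<Prod>k=1..m. [:?l k, 1:]"]
    by (simp_all only: deg degree_chebyshev_complex order_refl)
  have "inj_on (\<lambda>k. - ?l k) {1..m}"
    by (intro inj_onI inj_onD[OF inj_on_cheb_lambda_odd[of m]])
      (simp_all only: neg_equal_iff_equal of_real_eq_iff)
  thus "m \<le> card ((\<lambda>k. - ?l k) ` {1..m})"
    by (simp add: card_image)
next
  fix z assume "z \<in> (\<lambda>k. - ?l k) ` {1..m}"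
  then obtain k where k: "k \<in> {1..m}" "z = - ?l k" by blast
  have "poly (\<Prod>k=1..m. [:?l k, 1:]) z = 0"
    using k by (auto simp: poly_prod prod_zero_iff)
  thus "poly ?T z = poly (smult ?c (\<Prod>k=1..m. [:?l k, 1:])) z"
    using poly_chebyshev_complex_lambda[OF k(1)] k(2) by simp
qed

lemma eval2_prod: "eval2 (\<Prod>k\<in>A. f k) x y = (\<Prod>k\<in>A. eval2 (f k) x y)"
  by (simp add: eval2_def poly_prod)

lemma eval2_g_plus:
  "eval2 (g_plus d k) x y = x ^ 2 + 2 * of_real (cheb_lambda d (2 * k - 1)) * x * y + y ^ 2
     - (1 - of_real (cheb_lambda d (2 * k - 1)) ^ 2)"
  by (simp add: g_plus_def Let_def)

text \<open>The right side is a difference of squares, since cos (a + b) and cos (a - b) are cos a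
  cos b minus and plus sin a sin b. Only squares of the sines survive, so it is a polynomial in the
  two cosines.\<close>

lemma conic_cos_cos:
  fixes a b l :: complex
  shows "cos a ^ 2 + 2 * l * cos a * cos b + cos b ^ 2 - (1 - l ^ 2) =
    (l + cos (a + b)) * (l + cos (a - b))"
proof -
  have "(l + cos (a + b)) * (l + cos (a - b)) = (l + cos a * cos b) ^ 2 - (sin a) ^ 2 * (sin b) ^ 2"
    by (simp add: cos_add cos_diff power2_eq_square algebra_simps)
  also have "\<dots> = (l + cos a * cos b) ^ 2 - (1 - cos a ^ 2) * (1 - cos b ^ 2)"
    by (simp add: sin_squared_eq)
  finally show ?thesis by (simp add: power2_eq_square algebra_simps)
qed

lemma F_plus_eq_prod:
  "F_plus (2 * m) = bconst (2 * lead_coeff (chebyshev_complex m) ^ 2) * (\<Prod>k=1..m. g_plus (2 * m) k)"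
proof (rule eval2_eqI)
  fix x y :: complex
  \<comment> \<open>Every complex number is the cosine of a complex angle, so this substitution
    reaches all points.\<close>
  define a b where "a = Arccos x" and "b = Arccos y"
  have xy: "x = cos a" "y = cos b" by (simp_all add: a_def b_def)
  let ?l = "\<lambda>k. complex_of_real (cheb_lambda (2 * m) (2 * k - 1))"
  let ?c = "lead_coeff (chebyshev_complex m)"
  have T: "cos (of_nat m * z) = ?c * (\<Prod>k=1..m. ?l k + cos z)" for z
    unfolding poly_chebyshev_complex_cos[symmetric]
    by (subst chebyshev_complex_eq_prod) (simp add: poly_prod)
  have "eval2 (F_plus (2 * m)) x y = cos (of_nat (2 * m) * a) + cos (of_nat (2 * m) * b)"
    by (simp only: F_plus_def eval2_simps eval2_subst1 xy poly_chebyshev_complex_cos)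
  also have "\<dots> = 2 * cos (of_nat m * (a + b)) * cos (of_nat m * (a - b))"
    by (simp add: cos_plus_cos algebra_simps diff_divide_distrib add_divide_distrib)
  \<comment> \<open>Each of the two factors contributes one \<open>?c\<close>; pairing their k-th
    linear factors yields the k-th conic.\<close>
  also have "\<dots> = 2 * ?c ^ 2 * (\<Prod>k=1..m. (?l k + cos (a + b)) * (?l k + cos (a - b)))"
    unfolding T prod.distrib by (simp add: power2_eq_square)
  also have "\<dots> = eval2 (bconst (2 * ?c ^ 2) * (\<Prod>k=1..m. g_plus (2 * m) k)) x y"
    by (simp only: eval2_simps eval2_prod eval2_g_plus xy conic_cos_cos)
  finally show "eval2 (F_plus (2 * m)) x y =
      eval2 (bconst (2 * ?c ^ 2) * (\<Prod>k=1..m. g_plus (2 * m) k)) x y" .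
qed

lemma lead_coeff_chebyshev_complex_nonzero: "lead_coeff (chebyshev_complex m) \<noteq> 0"
  using poly_chebyshev_complex_cos[of m 0] by auto

text \<open>Restrict the conic to the line (p, q) + t (u, v): \<open>B\<close> and \<open>Q\<close>
  kill the coefficients of t and t^2, and the conclusion says that the constant term then
  survives.\<close>

lemma conic_contains_no_line:
  fixes l p q u v :: complex
  assumes l: "l ^ 2 \<noteq> 1" and uv: "u \<noteq> 0 \<or> v \<noteq> 0"
    and B: "p * u + q * v + l * (p * v + q * u) = 0"
    and Q: "u ^ 2 + 2 * l * u * v + v ^ 2 = 0"
  shows "p ^ 2 + 2 * l * p * q + q ^ 2 \<noteq> 1 - l ^ 2"
proof
  assume 1: "p ^ 2 + 2 * l * p * q + q ^ 2 = 1 - l ^ 2"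
  \<comment> \<open>Gram determinant identity for the quadratic form x^2 + 2lxy + y^2, whose
    determinant is 1 - l^2. It forces (p, q) to be parallel to (u, v).\<close>
  have "(1 - l ^ 2) * (u * q - v * p) ^ 2 =
    (u ^ 2 + 2 * l * u * v + v ^ 2) * (p ^ 2 + 2 * l * p * q + q ^ 2)
    - (p * u + q * v + l * (p * v + q * u)) ^ 2"
    by (simp add: power2_eq_square algebra_simps)
  hence par: "u * q = v * p" using B Q l by simp
  \<comment> \<open>For parallel vectors the form at (p, q) is a multiple of its value at (u, v),
    hence 0, although 1 - l^2 is nonzero.\<close>
  have "u ^ 2 * (p ^ 2 + 2 * l * p * q + q ^ 2) = p ^ 2 * (u ^ 2 + 2 * l * u * v + v ^ 2)
      + (u * q - v * p) * (2 * l * u * p + u * q + v * p)"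
    "v ^ 2 * (p ^ 2 + 2 * l * p * q + q ^ 2) = q ^ 2 * (u ^ 2 + 2 * l * u * v + v ^ 2)
      - (u * q - v * p) * (2 * l * v * q + u * q + v * p)"
    by (simp_all add: power2_eq_square algebra_simps)
  thus False using par Q 1 l uv by auto
qed

lemma F_plus_no_line:
  assumes uv: "u \<noteq> 0 \<or> v \<noteq> 0"
  shows "\<exists>t. eval2 (F_plus (2 * m)) (p + u * t) (q + v * t) \<noteq> 0"
proof (rule ccontr)
  assume "\<not> ?thesis"
  hence vanish: "eval2 (F_plus (2 * m)) (p + u * t) (q + v * t) = 0" for t by blast
  let ?l = "\<lambda>k. complex_of_real (cheb_lambda (2 * m) (2 * k - 1))"
  define h where "h = (\<lambda>k. [:p ^ 2 + 2 * ?l k * p * q + q ^ 2 - (1 - ?l k ^ 2),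
    2 * (p * u + q * v + ?l k * (p * v + q * u)), u ^ 2 + 2 * ?l k * u * v + v ^ 2:])"
  have h: "eval2 (g_plus (2 * m) k) (p + u * t) (q + v * t) = poly (h k) t" for k t
    by (simp add: eval2_g_plus h_def power2_eq_square algebra_simps)
  have "poly (\<Prod>k=1..m. h k) t = 0" for t
    using vanish[of t] lead_coeff_chebyshev_complex_nonzero[of m]
    by (simp add: F_plus_eq_prod eval2_prod h poly_prod)
  \<comment> \<open>Polynomials in t form an integral domain, so a single conic must already contain
    the whole line.\<close>
  hence "(\<Prod>k=1..m. h k) = 0"
    using poly_all_0_iff_0 by blast
  then obtain k where k: "k \<in> {1..m}" "h k = 0"
    by (auto simp: prod_zero_iff)
  have "?l k ^ 2 \<noteq> 1"
    using cheb_lambda_odd_sq[OF k(1)] by (metis of_real_eq_1_iff of_real_power)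
  moreover have "2 * (p * u + q * v + ?l k * (p * v + q * u)) = 0"
      and "u ^ 2 + 2 * ?l k * u * v + v ^ 2 = 0" and "p ^ 2 + 2 * ?l k * p * q + q ^ 2 = 1 - ?l k ^ 2"
    using k(2) by (simp_all only: h_def pCons_eq_0_iff right_minus_eq)
  moreover from this(1) have "p * u + q * v + ?l k * (p * v + q * u) = 0"
    by (simp only: mult_eq_0_iff) simp
  ultimately show False
    using conic_contains_no_line[OF _ uv] by blast
qed

lemma not_affinely_equivalent_F: "\<not> affinely_equivalent (F_plus (2 * m)) (F_minus (2 * m))"
proof
  assume "affinely_equivalent (F_plus (2 * m)) (F_minus (2 * m))"
  then obtain a b c d r s where D: "a * d - b * c \<noteq> 0"
    and F: "F_minus (2 * m) = subst2 (F_plus (2 * m)) (bconst a * varX + bconst b * varY + bconst r)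
                     (bconst c * varX + bconst d * varY + bconst s)"
    unfolding affinely_equivalent_def by blast
  \<comment> \<open>The affine map sends the diagonal x = y to the line through (r, s) with
    direction (a + b, c + d); invertibility keeps this direction nonzero.\<close>
  have "a + b \<noteq> 0 \<or> c + d \<noteq> 0"
  proof (rule ccontr)
    assume "\<not> ?thesis"
    hence "b = - a" "d = - c" by (auto simp: add_eq_0_iff)
    thus False using D by simp
  qed
  then obtain t where "eval2 (F_plus (2 * m)) (r + (a + b) * t) (s + (c + d) * t) \<noteq> 0"
    using F_plus_no_line by blast
  moreover have "eval2 (F_minus (2 * m)) t t = 0"
    by (simp add: F_minus_def eval2_subst1)
  ultimately show False
    unfolding F by (simp add: eval2_subst2 algebra_simps)
qed

theorem corollary2p3:
  fixes d m :: nat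
  assumes "m \<ge> 1" and "d = 2 * m"
  shows "(\<exists>c::complex. c \<noteq> 0 \<and> F_plus d = bconst c * (\<Prod>k=1..m. g_plus d k))
       \<and> \<not> affinely_equivalent (F_plus d) (F_minus d)"
proof
  show "\<exists>c::complex. c \<noteq> 0 \<and> F_plus d = bconst c * (\<Prod>k=1..m. g_plus d k)"
    unfolding assms(2) using F_plus_eq_prod lead_coeff_chebyshev_complex_nonzero[of m]
    by (intro exI[of _ "2 * lead_coeff (chebyshev_complex m) ^ 2"]) simp
  show "\<not> affinely_equivalent (F_plus d) (F_minus d)"
    unfolding assms(2) by (rule not_affinely_equivalent_F)
qed

end
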